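(* Drift-less, purely dissipative setting with target $\rho_d=|\Psi\rangle\langle\Psi|$, neighborhoods $\mathcal N_1,\dots,\mathcal N_M$, and a subspace $\mathcal H'$ with $\mathcal H_d\subseteq\mathcal H'\subsetneq\mathcal H$ and orthogonal projector $\Pi'$. For each $k$ let $\{\sigma_{jk}\}_j$ be a basis of the real vector space of operators $X\otimes I_{\bar{\mathcal N}_k}$, and for real $\beta=(\beta_{jk})$ let $D_k(\beta)=\sum_j\beta_{jk}\sigma_{jk}$. Let $W$ be the real linear subspace of $\beta$ such that, for all $k$, $D_k(\beta)|\Psi\rangle=0$ and $[D_k(\beta),\Pi']=0$ (so that $\rho_d$, $\mathfrak D(\mathcal H')$ and $\mathfrak D(\mathcal H'^\perp)$ are invariant), and let $C$ be the cube with all entries in $[-\gamma,\gamma]$, $\gamma>0$. If there exists $\beta\in W$ such that $\rho_d$ is conditionally asymptotically stable relative to $\mathcal H'$ for $\mathcal L(0,\{D_k(\beta)\})$, then the set of $\beta\in W\cap C$ for which this fails has zero Lebesgue measure in $W$.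
   Context: $\mathcal H=\bigotimes_{a=1}^n\mathcal H_a$ finite-dimensional, $\mathcal H_d=\mathrm{span}\{|\Psi\rangle\}$, $\mathcal H'^\perp=\mathcal H\ominus\mathcal H'$. $\mathfrak D(\mathcal K)$: density operators supported in $\mathcal K$. $\mathcal L(0,\{D_k\})(\rho)=\sum_k(D_k\rho D_k^\dagger-\frac12\{D_k^\dagger D_k,\rho\})$. Conditional asymptotic stability relative to $\mathcal H'$: $e^{\mathcal Lt}(\rho_0)\to\rho_d$ for all $\rho_0\in\mathfrak D(\mathcal H')$. *)

theory Defs
  imports "HOL-Analysis.Analysis"
begin

(* Operators on the finite-dimensional Hilbert space H = C^'h are complex matrices
   complex^'h^'h; the tensor-product structure H = H_0 (x) ... (x) H_(n-1) is given by a
   bijection enc from the index type 'h onto the product basis (configurations). *)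

type_synonym 'h op = "complex^'h^'h"

definition cfgs :: "nat \<Rightarrow> (nat \<Rightarrow> nat) \<Rightarrow> (nat \<Rightarrow> nat) set" where
  "cfgs n d = {i. (\<forall>a<n. i a < d a) \<and> (\<forall>a\<ge>n. i a = 0)}"

definition adj :: "'h::finite op \<Rightarrow> 'h op" where
  "adj A = (\<chi> i j. cnj (A $ j $ i))"

definition ket_bra :: "complex^'h \<Rightarrow> complex^'h \<Rightarrow> 'h::finite op" where
  "ket_bra u v = (\<chi> i j. u $ i * cnj (v $ j))"

definition trace :: "'h::finite op \<Rightarrow> complex" where
  "trace A = (\<Sum>i\<in>UNIV. A $ i $ i)"

(* operators of the form X (x) I on the complement of the neighbourhood N *)
definition local_ops :: "('h \<Rightarrow> nat \<Rightarrow> nat) \<Rightarrow> nat set \<Rightarrow> 'h::finite op set" where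
  "local_ops enc N = {A. \<exists>X :: (nat \<Rightarrow> nat) \<Rightarrow> (nat \<Rightarrow> nat) \<Rightarrow> complex.
      \<forall>i j. A $ i $ j =
        (if (\<forall>a. a \<notin> N \<longrightarrow> enc i a = enc j a)
         then X (\<lambda>a. if a \<in> N then enc i a else 0) (\<lambda>a. if a \<in> N then enc j a else 0)
         else 0)}"

definition density_in :: "'h::finite op \<Rightarrow> 'h op set" where
  "density_in P = {\<rho>. (\<forall>v. Im (\<Sum>i\<in>UNIV. cnj (v $ i) * (\<rho> *v v) $ i) = 0
                          \<and> Re (\<Sum>i\<in>UNIV. cnj (v $ i) * (\<rho> *v v) $ i) \<ge> 0)
                    \<and> trace \<rho> = 1 \<and> P ** \<rho> ** P = \<rho>}"

definition lindblad :: "nat \<Rightarrow> (nat \<Rightarrow> 'h::finite op) \<Rightarrow> 'h op \<Rightarrow> 'h op" where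
  "lindblad M D \<rho> = (\<Sum>k<M. D k ** \<rho> ** adj (D k)
       - (1/2 :: real) *\<^sub>R (adj (D k) ** D k ** \<rho> + \<rho> ** (adj (D k) ** D k)))"

definition semigroup :: "('h::finite op \<Rightarrow> 'h op) \<Rightarrow> real \<Rightarrow> 'h op \<Rightarrow> 'h op" where
  "semigroup L t \<rho> = (\<Sum>m. (t ^ m / fact m) *\<^sub>R (L ^^ m) \<rho>)"

definition cond_as_stable :: "('h::finite op \<Rightarrow> 'h op) \<Rightarrow> complex^'h \<Rightarrow> 'h op \<Rightarrow> bool" where
  "cond_as_stable L \<Psi> P \<longleftrightarrow>
     (\<forall>\<rho>0 \<in> density_in P. ((\<lambda>t. semigroup L t \<rho>0) \<longlongrightarrow> ket_bra \<Psi> \<Psi>) at_top)"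

definition Dk :: "(nat \<Rightarrow> nat) \<Rightarrow> (nat \<Rightarrow> nat \<Rightarrow> 'h::finite op) \<Rightarrow> (nat \<Rightarrow> nat \<Rightarrow> real) \<Rightarrow> nat \<Rightarrow> 'h op" where
  "Dk J \<sigma> \<beta> k = (\<Sum>j<J k. \<beta> j k *\<^sub>R \<sigma> j k)"

definition params :: "nat \<Rightarrow> (nat \<Rightarrow> nat) \<Rightarrow> (nat \<Rightarrow> nat \<Rightarrow> real) set" where
  "params M J = {\<beta>. \<forall>j k. \<not> (k < M \<and> j < J k) \<longrightarrow> \<beta> j k = 0}"

definition Wset :: "nat \<Rightarrow> (nat \<Rightarrow> nat) \<Rightarrow> (nat \<Rightarrow> nat \<Rightarrow> 'h::finite op) \<Rightarrow> complex^'h \<Rightarrow> 'h op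
                     \<Rightarrow> (nat \<Rightarrow> nat \<Rightarrow> real) set" where
  "Wset M J \<sigma> \<Psi> P = {\<beta> \<in> params M J. \<forall>k<M. Dk J \<sigma> \<beta> k *v \<Psi> = 0
                         \<and> Dk J \<sigma> \<beta> k ** P = P ** Dk J \<sigma> \<beta> k}"

definition cube :: "real \<Rightarrow> (nat \<Rightarrow> nat \<Rightarrow> real) set" where
  "cube \<gamma> = {\<beta>. \<forall>j k. \<bar>\<beta> j k\<bar> \<le> \<gamma>}"

end

theory Submission
  imports Defs
begin

text \<open>
  Restrict the generator \<open>L\<close> to the self-adjoint operators supported in \<open>P\<close>. There the target
  is stable if and only if \<open>L\<close> is injective on the traceless operators. Stability clearly
  forces this. Conversely, injectivity makes the infidelity \<open>1 - F\<close> a functional \<open>f \<circ> L\<close>, i.e. the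
  time derivative of the bounded quantity \<open>f (\<rho>(t))\<close>; since all \<open>D k\<close> annihilate the target vector,
  \<open>F\<close> is nondecreasing along trajectories, and hence \<open>1 - F = O(1/t)\<close>.

  Injectivity is turned into injectivity of a linear map \<open>R\<close> on all operators that depends
  quadratically on the parameters. On a line through a stable parameter, \<open>R\<close> is a quadratic pencil
  \<open>A + t B + t\<^sup>2 C\<close> with \<open>A\<close> invertible, which is singular for only finitely many \<open>t\<close>. By Fubini, a closed
  set that meets every line through one point in a null set is itself null.
\<close>

section \<open>Complex matrices as a real inner product space\<close>

lemma inner_vec_complex: "(v::complex^'h::finite) \<bullet> w = Re (\<Sum>i\<in>UNIV. cnj (v $ i) * w $ i)"
  by (simp add: inner_vec_def inner_complex_def)

lemma inner_vec_complex_Im: "(\<i> *s (v::complex^'h::finite)) \<bullet> w = Im (\<Sum>i\<in>UNIV. cnj (v $ i) * w $ i)"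
  by (simp add: inner_vec_def inner_complex_def)

lemma bounded_bilinear_matrix_mult: "bounded_bilinear ((**) :: 'h::finite op \<Rightarrow> 'h op \<Rightarrow> 'h op)"
  by (auto simp: bilinear_conv_bounded_bilinear[symmetric] bilinear_def intro!: linearI)
     (simp_all add: vec_eq_iff matrix_matrix_mult_def algebra_simps sum.distrib scaleR_sum_right)

interpretation mm: bounded_bilinear "(**) :: 'h::finite op \<Rightarrow> 'h op \<Rightarrow> 'h op"
  by (rule bounded_bilinear_matrix_mult)

lemma bounded_bilinear_matrix_vector_mult:
  "bounded_bilinear ((*v) :: 'h::finite op \<Rightarrow> complex^'h \<Rightarrow> complex^'h)"
  by (auto simp: bilinear_conv_bounded_bilinear[symmetric] bilinear_def intro!: linearI)
     (simp_all add: vec_eq_iff matrix_vector_mult_def algebra_simps sum.distrib scaleR_sum_right)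

interpretation mv: bounded_bilinear "(*v) :: 'h::finite op \<Rightarrow> complex^'h \<Rightarrow> complex^'h"
  by (rule bounded_bilinear_matrix_vector_mult)

lemma linear_adj: "linear (adj :: 'h::finite op \<Rightarrow> 'h op)"
  by (rule linearI) (simp_all add: adj_def vec_eq_iff)

lemmas adj_simps = linear_add[OF linear_adj] linear_diff[OF linear_adj] linear_sum[OF linear_adj]
  linear_scale[OF linear_adj]

lemma adj_adj [simp]: "adj (adj A) = A"
  by (simp add: adj_def vec_eq_iff)

lemma adj_mult: "adj (A ** B) = adj B ** adj A"
  by (simp add: adj_def vec_eq_iff matrix_matrix_mult_def mult.commute)

lemma inner_adj: "u \<bullet> (adj A *v w) = (A *v u) \<bullet> w"
proof -
  have "(\<Sum>i\<in>UNIV. cnj (u $ i) * (adj A *v w) $ i) = (\<Sum>i\<in>UNIV. \<Sum>j\<in>UNIV. cnj (u $ i) * (cnj (A $ j $ i) * w $ j))"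
    by (simp add: matrix_vector_mult_def adj_def sum_distrib_left)
  also have "\<dots> = (\<Sum>j\<in>UNIV. \<Sum>i\<in>UNIV. cnj (u $ i) * (cnj (A $ j $ i) * w $ j))"
    by (rule sum.swap)
  also have "\<dots> = (\<Sum>j\<in>UNIV. cnj ((A *v u) $ j) * w $ j)"
    by (simp add: matrix_vector_mult_def sum_distrib_left sum_distrib_right mult_ac)
  finally show ?thesis by (simp add: inner_vec_complex)
qed

lemma linear_trace: "linear (trace :: 'h::finite op \<Rightarrow> complex)"
  by (rule linearI) (simp_all add: trace_def sum.distrib scaleR_sum_right)

lemmas trace_simps = linear_add[OF linear_trace] linear_diff[OF linear_trace]
  linear_sum[OF linear_trace] linear_scale[OF linear_trace]

lemma trace_mult_commute: "trace (A ** B) = trace (B ** A)"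
  unfolding trace_def matrix_matrix_mult_def
  by (simp, subst sum.swap) (simp add: mult.commute)

lemma trace_adj: "trace (adj A) = cnj (trace A)"
  by (simp add: trace_def adj_def)

lemma mult_ket_bra: "A ** ket_bra u v = ket_bra (A *v u) v"
  by (simp add: vec_eq_iff ket_bra_def matrix_matrix_mult_def matrix_vector_mult_def
      sum_distrib_right mult.assoc)

lemma adj_ket_bra: "adj (ket_bra u v) = ket_bra v u"
  by (simp add: vec_eq_iff ket_bra_def adj_def mult.commute)

lemma ket_bra_mult: "ket_bra u v ** A = ket_bra u (adj A *v v)"
  by (metis adj_adj adj_ket_bra adj_mult mult_ket_bra)

lemma ket_bra_zero [simp]: "ket_bra 0 v = 0" "ket_bra u 0 = 0"
  by (simp_all add: vec_eq_iff ket_bra_def)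

lemma trace_ket_bra: "Re (trace (ket_bra u u)) = (norm u)\<^sup>2"
  by (simp add: trace_def ket_bra_def power2_norm_eq_inner inner_vec_complex mult.commute)

lemma inner_ket_bra: "X \<bullet> ket_bra u u = u \<bullet> (X *v u)"
proof -
  have "X \<bullet> ket_bra u u = (\<Sum>i\<in>UNIV. \<Sum>j\<in>UNIV. Re (cnj (u $ i) * (X $ i $ j * u $ j)))"
    by (simp add: inner_vec_def inner_complex_def ket_bra_def algebra_simps)
  then show ?thesis
    by (simp add: inner_vec_complex matrix_vector_mult_def sum_distrib_left)
qed

lemma norm_ket_bra: "norm (ket_bra u u) = (norm u)\<^sup>2"
proof -
  have "ket_bra u u *v u = ((norm u)\<^sup>2 :: real) *\<^sub>R u"
  proof -
    have "(\<Sum>i\<in>UNIV. cnj (u $ i) * u $ i) = of_real ((norm u)\<^sup>2)"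
      by (simp add: complex_eq_iff power2_norm_eq_inner inner_vec_complex mult.commute)
    then have "\<And>i. (\<Sum>j\<in>UNIV. u $ i * cnj (u $ j) * u $ j) = of_real ((norm u)\<^sup>2) * u $ i"
      by (simp add: mult.assoc flip: sum_distrib_left)
    then show ?thesis
      unfolding vec_eq_iff vector_scaleR_component scaleR_conv_of_real[where 'a = complex]
      by (simp add: ket_bra_def matrix_vector_mult_def)
  qed
  then have "ket_bra u u \<bullet> ket_bra u u = ((norm u)\<^sup>2)\<^sup>2"
    unfolding inner_ket_bra by (simp add: dot_square_norm power2_eq_square)
  then show ?thesis by (simp add: norm_eq_sqrt_inner)
qed

lemma self_adjoint_iff_inner: "adj X = X \<longleftrightarrow> (\<forall>u w. u \<bullet> (X *v w) = (X *v u) \<bullet> w)"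
proof
  assume "adj X = X"
  then show "\<forall>u w. u \<bullet> (X *v w) = (X *v u) \<bullet> w" using inner_adj[of _ X] by simp
next
  assume "\<forall>u w. u \<bullet> (X *v w) = (X *v u) \<bullet> w"
  then have "\<And>u w. u \<bullet> (adj X *v w) = u \<bullet> (X *v w)" by (simp add: inner_adj)
  then show "adj X = X" by (metis vector_eq_ldot matrix_eq)
qed

lemma matrix_vector_smult: "(X::'h::finite op) *v (c *s v) = c *s (X *v v)"
  by (simp add: vec_eq_iff matrix_vector_mult_def sum_distrib_left algebra_simps)

lemma inner_ii: "(\<i> *s (u::complex^'h::finite)) \<bullet> w = - (u \<bullet> (\<i> *s w))"
  by (simp add: inner_vec_def inner_complex_def flip: sum_negf)

text \<open>Polarization of the quadratic form. It makes the reality condition in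
  \<open>density_in\<close> yield Hermitian operators.\<close>

lemma self_adjoint_iff_Im:
  "adj X = X \<longleftrightarrow> (\<forall>v. Im (\<Sum>i\<in>UNIV. cnj (v $ i) * (X *v v) $ i) = 0)"
proof
  assume "adj X = X"
  then have s: "\<And>u w. u \<bullet> (X *v w) = (X *v u) \<bullet> w" by (simp add: self_adjoint_iff_inner)
  have "(\<i> *s v) \<bullet> (X *v v) = 0" for v
    using s[of "\<i> *s v" v] inner_ii[of v "X *v v"]
    by (simp add: inner_ii matrix_vector_smult inner_commute)
  then show "\<forall>v. Im (\<Sum>i\<in>UNIV. cnj (v $ i) * (X *v v) $ i) = 0"
    by (simp add: inner_vec_complex_Im)
next
  assume "\<forall>v. Im (\<Sum>i\<in>UNIV. cnj (v $ i) * (X *v v) $ i) = 0"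
  then have z: "(\<i> *s v) \<bullet> (X *v v) = 0" for v by (simp add: inner_vec_complex_Im)
  have "u \<bullet> (X *v w) = (X *v u) \<bullet> w" for u w
  proof -
    \<comment> \<open>Polarizing at \<open>u'\<close> instead of \<open>u\<close> cancels the factor
      \<open>\<i>\<close>, leaving the real inner product.\<close>
    define u' where "u' = (-\<i>) *s u"
    have u: "\<i> *s u' = u" by (simp add: u'_def vec_eq_iff)
    have "(\<i> *s u') \<bullet> (X *v w) + (\<i> *s w) \<bullet> (X *v u') = 0"
      using z[of "u' + w"] z[of u'] z[of w]
      by (simp add: matrix_vector_right_distrib inner_add_left inner_add_right vector_add_ldistrib)
    moreover have "(\<i> *s w) \<bullet> (X *v u') = - (w \<bullet> (X *v u))"
      by (simp add: inner_ii u flip: matrix_vector_smult)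
    ultimately show ?thesis by (simp add: u inner_commute)
  qed
  then show "adj X = X" by (simp add: self_adjoint_iff_inner)
qed

text \<open>\<open>\<bullet>\<close> is the real inner product \<open>Re \<langle>v, w\<rangle>\<close>, so \<open>psd X\<close> does not make \<open>X\<close> self-adjoint.\<close>

definition psd :: "'h::finite op \<Rightarrow> bool" where
  "psd X \<longleftrightarrow> (\<forall>v. 0 \<le> v \<bullet> (X *v v))"

lemma density_in_iff:
  "\<rho> \<in> density_in P \<longleftrightarrow> adj \<rho> = \<rho> \<and> psd \<rho> \<and> trace \<rho> = 1 \<and> P ** \<rho> ** P = \<rho>"
  by (auto simp: density_in_def self_adjoint_iff_Im psd_def inner_vec_complex)

text \<open>The binary quadratic form \<open>q\<close> is nonnegative, so its discriminant is not
  positive. The case \<open>a = 0\<close> is separate because the form of \<open>X\<close> may be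
  degenerate.\<close>

lemma psd_Cauchy_Schwarz:
  assumes "adj X = X" "psd X"
  shows "(u \<bullet> (X *v w))\<^sup>2 \<le> (u \<bullet> (X *v u)) * (w \<bullet> (X *v w))"
proof -
  define a b c where "a = u \<bullet> (X *v u)" and "b = u \<bullet> (X *v w)" and "c = w \<bullet> (X *v w)"
  have s: "w \<bullet> (X *v u) = b"
    using assms(1) by (metis b_def inner_commute self_adjoint_iff_inner)
  have q: "0 \<le> x\<^sup>2 * a + 2 * x * y * b + y\<^sup>2 * c" for x y
  proof -
    have "0 \<le> (x *\<^sub>R u + y *\<^sub>R w) \<bullet> (X *v (x *\<^sub>R u + y *\<^sub>R w))"
      using assms(2) by (simp add: psd_def)
    also have "\<dots> = x\<^sup>2 * a + 2 * x * y * b + y\<^sup>2 * c"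
      by (simp add: mv.add_right mv.scaleR_right inner_add_left inner_add_right s a_def[symmetric]
          b_def[symmetric] c_def[symmetric] power2_eq_square algebra_simps)
    finally show ?thesis .
  qed
  have a0: "0 \<le> a" using assms(2) by (simp add: psd_def a_def)
  show ?thesis unfolding a_def[symmetric] b_def[symmetric] c_def[symmetric]
  proof (cases "a = 0")
    case True
    have "b = 0"
    proof (rule ccontr)
      assume "b \<noteq> 0"
      \<comment> \<open>With \<open>a = 0\<close> the form is linear in \<open>x\<close>; this
        \<open>x\<close> and \<open>y = 1\<close> give the value \<open>-1\<close>.\<close>
      then show False using q[of "-(c + 1) / (2 * b)" 1] True by (simp add: field_simps)
    qed
    then show "b\<^sup>2 \<le> a * c" using True by simp
  next
    case False
    have "0 \<le> a * (a * c - b\<^sup>2)" using q[of "-b" a] by (simp add: power2_eq_square algebra_simps)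
    then show "b\<^sup>2 \<le> a * c" using False a0 by (simp add: zero_le_mult_iff)
  qed
qed

text \<open>Cauchy-Schwarz at basis vectors bounds each squared entry by the product of the diagonal
  entries of its row and column; the sum of these products is the squared trace. The norm is the
  Frobenius norm.\<close>

lemma norm_le_trace:
  assumes "adj X = X" "psd X"
  shows "norm X \<le> Re (trace X)"
proof -
  have col: "(X *v axis j 1) $ i = X $ i $ j" for i j
    by (simp add: matrix_vector_mult_def axis_def if_distrib cong: if_cong)
  have ax: "axis i c \<bullet> w = Re (cnj c * w $ i)" for i and c :: complex and w
    by (simp add: inner_axis inner_axis' inner_complex_def)
  have axc: "axis i c = c *s axis i 1" for i and c :: complex
    by (simp add: vec_eq_iff axis_def)
  have d: "0 \<le> Re (X $ i $ i)" for i
    using assms(2) by (auto simp: psd_def ax col dest: spec[of _ "axis i 1"])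
  have e: "(cmod (X $ i $ j))\<^sup>2 \<le> Re (X $ i $ i) * Re (X $ j $ j)" for i j
  proof (cases "X $ i $ j = 0")
    case True then show ?thesis using d by simp
  next
    case False
    define c where "c = X $ i $ j"
    have c2: "Re c * Re c + Im c * Im c = (cmod c)\<^sup>2"
      using cmod_power2[of c] by (simp add: power2_eq_square)
    \<comment> \<open>Scaling the basis vector by the entry \<open>c\<close> itself makes the
      pairing real, so the real inner product sees the full modulus.\<close>
    have "axis i c \<bullet> (X *v axis j 1) = (cmod c)\<^sup>2"
      by (simp add: ax col c2 flip: c_def)
    moreover have "axis i c \<bullet> (X *v axis i c) = (cmod c)\<^sup>2 * Re (X $ i $ i)"
      by (subst (2) axc)
        (simp add: ax matrix_vector_smult col algebra_simps flip: c2)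
    moreover have "axis j 1 \<bullet> (X *v axis j 1) = Re (X $ j $ j)"
      by (simp add: ax col)
    ultimately have "((cmod c)\<^sup>2)\<^sup>2 \<le> (cmod c)\<^sup>2 * Re (X $ i $ i) * Re (X $ j $ j)"
      using psd_Cauchy_Schwarz[OF assms, of "axis i c" "axis j 1"] by simp
    then have "(cmod c)\<^sup>2 * (cmod c)\<^sup>2 \<le> (cmod c)\<^sup>2 * (Re (X $ i $ i) * Re (X $ j $ j))"
      by (simp add: power2_eq_square algebra_simps)
    then have "(cmod c)\<^sup>2 \<le> Re (X $ i $ i) * Re (X $ j $ j)"
      by (rule mult_left_le_imp_le) (use False in \<open>simp add: c_def\<close>)
    then show ?thesis by (simp add: c_def)
  qed
  have "(norm X)\<^sup>2 = (\<Sum>i\<in>UNIV. \<Sum>j\<in>UNIV. (cmod (X $ i $ j))\<^sup>2)"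
    by (simp add: power2_norm_eq_inner inner_vec_def)
  also have "\<dots> \<le> (\<Sum>i\<in>UNIV. \<Sum>j\<in>UNIV. Re (X $ i $ i) * Re (X $ j $ j))"
    by (intro sum_mono e)
  also have "\<dots> = (Re (trace X))\<^sup>2"
    by (simp add: trace_def sum_product power2_eq_square)
  finally show ?thesis
    by (rule power2_le_imp_le) (simp add: trace_def d sum_nonneg)
qed

section \<open>The semigroup of a generator and its positivity\<close>

lemma semigroup_summable:
  fixes L :: "'h::finite op \<Rightarrow> 'h op"
  assumes "linear L"
  shows "summable (\<lambda>m. (t ^ m / fact m) *\<^sub>R (L ^^ m) X)"
proof -
  obtain K where K: "K > 0" "\<And>Y. norm (L Y) \<le> K * norm Y"
    using linear_bounded_pos[OF assms] by blast
  have p: "norm ((L ^^ m) X) \<le> K ^ m * norm X" for m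
  proof (induction m)
    case (Suc m)
    have "norm ((L ^^ Suc m) X) \<le> K * norm ((L ^^ m) X)" using K by simp
    also have "\<dots> \<le> K * (K ^ m * norm X)" using Suc K by simp
    finally show ?case by simp
  qed simp
  have "summable (\<lambda>m. norm X * (inverse (fact m) * (\<bar>t\<bar> * K) ^ m))"
    by (intro summable_mult summable_exp)
  moreover have "norm ((t ^ m / fact m) *\<^sub>R (L ^^ m) X) \<le> norm X * (inverse (fact m) * (\<bar>t\<bar> * K) ^ m)" for m
    using mult_left_mono[OF p[of m], of "\<bar>t\<bar> ^ m / fact m"]
    by (simp add: power_abs power_mult_distrib field_simps)
  ultimately show ?thesis
    by (rule summable_comparison_test')
qed

text \<open>Linear maps are bounded in finite dimension and so pass inside the series;
  \<open>semigroup_commute\<close> and \<open>semigroup_invariant\<close> then compare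
  terms.\<close>

lemma semigroup_sums:
  fixes L :: "'h::finite op \<Rightarrow> 'h op" and f :: "'h op \<Rightarrow> 'b::real_normed_vector"
  assumes "linear L" "linear f"
  shows "(\<lambda>m. (t ^ m / fact m) *\<^sub>R f ((L ^^ m) X)) sums f (semigroup L t X)"
proof -
  have "(\<lambda>m. f ((t ^ m / fact m) *\<^sub>R (L ^^ m) X)) sums f (semigroup L t X)"
    unfolding semigroup_def
    using bounded_linear.sums[OF _ summable_sums[OF semigroup_summable[OF assms(1)]]] assms(2)
    by (simp add: linear_conv_bounded_linear)
  then show ?thesis by (simp add: linear_scale[OF assms(2)])
qed

lemma semigroup_commute:
  fixes L :: "'h::finite op \<Rightarrow> 'h op"
  assumes "linear L" "linear f" "\<And>Y. f (L Y) = L (f Y)"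
  shows "f (semigroup L t X) = semigroup L t (f X)"
proof -
  have "f ((L ^^ m) X) = (L ^^ m) (f X)" for m
    by (induction m) (simp_all add: assms)
  then show ?thesis
    using semigroup_sums[OF assms(1,2), of t X] by (simp add: semigroup_def sums_iff)
qed

lemma semigroup_invariant:
  fixes L :: "'h::finite op \<Rightarrow> 'h op" and f :: "'h op \<Rightarrow> 'b::real_normed_vector"
  assumes "linear L" "linear f" "\<And>Y. f (L Y) = 0"
  shows "f (semigroup L t X) = f X"
proof -
  have "(\<lambda>m. (t ^ m / fact m) *\<^sub>R f ((L ^^ m) X)) = (\<lambda>m. if m = 0 then f X else 0)"
    using assms(3) by (auto simp: fun_eq_iff gr0_conv_Suc)
  then have "(\<lambda>m. (t ^ m / fact m) *\<^sub>R f ((L ^^ m) X)) sums f X"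
    using sums_single[of 0 "\<lambda>_. f X"] by simp
  then show ?thesis using semigroup_sums[OF assms(1,2)] sums_unique2 by blast
qed

lemma semigroup_kernel:
  fixes L :: "'h::finite op \<Rightarrow> 'h op"
  assumes "linear L" "L X = 0"
  shows "semigroup L t X = X"
proof -
  have "(L ^^ Suc m) X = 0" for m
    by (induction m) (simp_all add: assms linear_0[OF assms(1)])
  then have "(\<lambda>m. (t ^ m / fact m) *\<^sub>R (L ^^ m) X) = (\<lambda>m. if m = 0 then X else 0)"
    by (auto simp: fun_eq_iff gr0_conv_Suc)
  then show ?thesis
    using sums_single[of 0 "\<lambda>_. X"] by (simp add: semigroup_def sums_iff)
qed

lemma semigroup_zero: "semigroup L 0 X = X"
proof -
  have "(\<lambda>m. (0 ^ m / fact m) *\<^sub>R (L ^^ m) X) = (\<lambda>m. if m = 0 then X else 0)"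
    by (auto simp: fun_eq_iff gr0_conv_Suc)
  then show ?thesis
    using sums_single[of 0 "\<lambda>_. X"] by (simp add: semigroup_def sums_iff)
qed

lemma linear_semigroup:
  fixes L :: "'h::finite op \<Rightarrow> 'h op"
  assumes "linear L"
  shows "linear (semigroup L t)"
proof -
  have l: "linear (L ^^ m)" for m
    by (induction m) (simp_all only: funpow.simps linear_id linear_compose assms)
  show ?thesis
  proof (rule linearI)
    show "semigroup L t (X + Y) = semigroup L t X + semigroup L t Y" for X Y
      using semigroup_summable[OF assms]
      by (simp add: semigroup_def linear_add[OF l] scaleR_add_right suminf_add)
    show "semigroup L t (r *\<^sub>R X) = r *\<^sub>R semigroup L t X" for r X
      using suminf_scaleR_right[OF semigroup_summable[OF assms, of t X], of r]
      by (simp add: semigroup_def linear_scale[OF l] mult.commute)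
  qed
qed

text \<open>Composing with the functional \<open>f\<close> leaves a scalar power series. Its
  termwise derivative shifts the index by one, which inserts one more \<open>L\<close>.\<close>

lemma DERIV_semigroup:
  fixes L :: "'h::finite op \<Rightarrow> 'h op" and f :: "'h op \<Rightarrow> real"
  assumes "linear L" "linear f"
  shows "((\<lambda>t. f (semigroup L t X)) has_real_derivative f (L (semigroup L t X))) (at t)"
proof -
  define c where "c = (\<lambda>m. f ((L ^^ m) X) / fact m)"
  have s: "(\<lambda>m. c m * t ^ m) sums f (semigroup L t X)" for t
    using semigroup_sums[OF assms] by (simp add: c_def mult.commute)
  have "((\<lambda>t. \<Sum>m. c m * t ^ m) has_real_derivative (\<Sum>m. diffs c m * t ^ m)) (at t)"
    using s by (intro termdiffs_strong_converges_everywhere) (auto simp: sums_iff)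
  moreover have "(\<lambda>m. diffs c m * t ^ m) sums f (L (semigroup L t X))"
  proof -
    have "linear (\<lambda>X. f (L X))" using linear_compose[OF assms] by (simp add: o_def)
    from semigroup_sums[OF assms(1) this, of t X] show ?thesis
      by (simp add: diffs_def c_def mult.commute del: of_nat_Suc)
  qed
  ultimately show ?thesis using s by (simp add: sums_iff)
qed

lemma continuous_on_semigroup:
  fixes L :: "'h::finite op \<Rightarrow> 'h op"
  assumes "linear L"
  shows "continuous_on S (\<lambda>t. semigroup L t X)"
proof -
  have "isCont (\<lambda>t. semigroup L t X \<bullet> b) t" for b t
    using DERIV_isCont[OF DERIV_semigroup[OF assms bounded_linear.linear[OF bounded_linear_inner_left]]] .
  then have "continuous_on S (\<lambda>t. \<Sum>b\<in>Basis. (semigroup L t X \<bullet> b) *\<^sub>R b)"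
    by (intro continuous_intros continuous_at_imp_continuous_on) auto
  then show ?thesis by (simp add: euclidean_representation)
qed

text \<open>The perturbation by \<open>\<epsilon> * exp (c * s)\<close> times the identity is strictly positive initially; at
  the first time it fails to be strictly positive, quasi-positivity makes the derivative in the
  critical direction positive, which is absurd.\<close>

lemma semigroup_psd:
  fixes L :: "'h::finite op \<Rightarrow> 'h op"
  assumes L: "linear L"
    and quasi: "\<And>X v. psd X \<Longrightarrow> v \<bullet> (X *v v) = 0 \<Longrightarrow> 0 \<le> v \<bullet> (L X *v v)"
    and X: "psd X" and t: "0 \<le> t"
  shows "psd (semigroup L t X)"
proof -
  obtain K where K: "\<And>v. norm (L (mat 1) *v v) \<le> norm v * K"
    using mv.bounded_linear_right bounded_linear.bounded by blast
  \<comment> \<open>One more than the bound \<open>K\<close>, so that the estimate below is strict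
    and the exponential outgrows the effect of \<open>L\<close> on the identity.\<close>
  define c where "c = K + 1"
  have c: "v \<bullet> (L (mat 1) *v v) < c" if "norm v = 1" for v
    using Cauchy_Schwarz_ineq2[of v "L (mat 1) *v v"] K[of v] that by (simp add: c_def)
  have pos: "0 < v \<bullet> (semigroup L t X *v v) + e * exp (c * t)"
    if e: "e > 0" and v: "norm v = 1" for e v
  proof (rule ccontr)
    assume neg: "\<not> ?thesis"
    define Y where "Y = (\<lambda>s. semigroup L s X + (e * exp (c * s)) *\<^sub>R mat 1)"
    define q where "q = (\<lambda>s v. v \<bullet> (Y s *v v))"
    have q: "q s v = v \<bullet> (semigroup L s X *v v) + e * exp (c * s) * (norm v)\<^sup>2" for s v
      by (simp add: q_def Y_def mv.add_left mv.scaleR_left inner_add_right power2_norm_eq_inner)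
    have Ycont: "continuous_on S Y" for S
      unfolding Y_def by (intro continuous_intros continuous_on_semigroup L)
    \<comment> \<open>Times and unit vectors at which positivity of the perturbed form fails;
      compactness provides the first such time \<open>s0\<close>.\<close>
    define B where "B = {z \<in> {0..t} \<times> sphere 0 1. q (fst z) (snd z) \<le> 0}"
    have cont2: "continuous_on S (\<lambda>z. q (fst z) (snd z))" for S
      unfolding q_def
      by (intro continuous_intros mv.continuous_on continuous_on_compose2[OF Ycont[of UNIV]]) auto
    have "B = ({0..t} \<times> sphere 0 1) \<inter> {z. q (fst z) (snd z) \<le> 0}" by (auto simp: B_def)
    moreover have "closed {z. q (fst z) (snd z) \<le> 0}"
      by (intro closed_Collect_le continuous_on_const cont2)
    ultimately have "compact B"
      by (simp add: compact_Int_closed compact_Times)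
    then have cB: "compact (fst ` B)" by (rule compact_continuous_image[rotated]) (intro continuous_intros)
    have "(t, v) \<in> B" using neg t v by (auto simp: B_def q)
    then obtain s0 where s0: "s0 \<in> fst ` B" "\<And>s. s \<in> fst ` B \<Longrightarrow> s0 \<le> s"
      using compact_attains_inf[OF cB] by blast
    then obtain v0 where v0: "norm v0 = 1" "q s0 v0 \<le> 0" and s0t: "0 \<le> s0" "s0 \<le> t"
      by (auto simp: B_def)
    have before: "0 < q s w" if "0 \<le> s" "s < s0" "norm w = 1" for s w
    proof (rule ccontr)
      assume "\<not> 0 < q s w"
      then have "(s, w) \<in> B" using that s0t by (auto simp: B_def)
      then show False using s0(2)[of s] that by force
    qed
    have "0 < q 0 w" if "norm w = 1" for w
      using X e that by (auto simp: q semigroup_zero psd_def intro: add_nonneg_pos)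
    then have s0pos: "0 < s0" using v0 s0t by (cases "s0 = 0") force+
    \<comment> \<open>At \<open>s0\<close> itself nonnegativity survives as a limit from the left,
      hence the form vanishes in the direction \<open>v0\<close>.\<close>
    have nonneg: "0 \<le> q s0 w" if w: "norm w = 1" for w
    proof (rule tendsto_lowerbound)
      have "continuous_on UNIV (\<lambda>s. q s w)"
        unfolding q_def by (intro continuous_intros mv.continuous_on Ycont)
      then show "((\<lambda>s. q s w) \<longlongrightarrow> q s0 w) (at_left s0)"
        by (auto simp: continuous_on_def intro: tendsto_within_subset)
      show "\<forall>\<^sub>F s in at_left s0. 0 \<le> q s w"
        using eventually_at_left_real[OF s0pos] by eventually_elim (auto intro!: less_imp_le before w)
    qed simp
    have psdY: "psd (Y s0)"
      unfolding psd_def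
    proof
      fix w
      show "0 \<le> w \<bullet> (Y s0 *v w)"
      proof (cases "w = 0")
        case False
        have "0 \<le> (norm w)\<^sup>2 * q s0 (sgn w)"
          using nonneg[of "sgn w"] False by (simp add: norm_sgn)
        also have "\<dots> = w \<bullet> (Y s0 *v w)"
          using False by (simp add: q_def sgn_div_norm mv.scaleR_right power2_eq_square field_simps)
        finally show ?thesis .
      qed simp
    qed
    have q0: "q s0 v0 = 0" using nonneg[of v0] v0 by simp
    have "linear (\<lambda>Y. v0 \<bullet> (Y *v v0))"
      by (rule linearI) (simp_all add: mv.add_left mv.scaleR_left inner_add_right)
    note d = DERIV_semigroup[OF L this, of X s0]
    define D where "D = v0 \<bullet> (L (semigroup L s0 X) *v v0) + e * (exp (c * s0) * c)"
    have "((\<lambda>s. q s v0) has_real_derivative D) (at s0)"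
      unfolding q D_def v0(1) by (auto intro!: derivative_eq_intros d)
    moreover have "0 < D"
    proof -
      \<comment> \<open>The generator is rewritten through \<open>Y s0\<close> because
        \<open>quasi\<close> applies there, the form of \<open>Y s0\<close> being null at
        \<open>v0\<close>; the leftover is absorbed by \<open>c\<close>.\<close>
      have LS: "L (semigroup L s0 X) = L (Y s0) - (e * exp (c * s0)) *\<^sub>R L (mat 1)"
        by (simp add: Y_def linear_add[OF L] linear_scale[OF L])
      have "D = v0 \<bullet> (L (Y s0) *v v0) + e * exp (c * s0) * (c - v0 \<bullet> (L (mat 1) *v v0))"
        unfolding D_def LS by (simp add: mv.diff_left mv.scaleR_left inner_diff_right algebra_simps)
      moreover have "0 \<le> v0 \<bullet> (L (Y s0) *v v0)"
        using quasi[OF psdY] q0 by (simp add: q_def)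
      ultimately show ?thesis using e c[OF v0(1)] by (simp add: add_nonneg_pos)
    qed
    ultimately obtain h where h: "h > 0" "\<And>r. r > 0 \<Longrightarrow> r < h \<Longrightarrow> q (s0 - r) v0 < q s0 v0"
      using DERIV_pos_inc_left by blast
    \<comment> \<open>The minimum keeps \<open>s0 - r\<close> nonnegative, so \<open>before\<close>
      applies: the value there would be both negative and positive.\<close>
    define r where "r = min (h / 2) s0"
    have "q (s0 - r) v0 < q s0 v0" using h s0pos by (intro h) (auto simp: r_def)
    moreover have "0 < q (s0 - r) v0"
      using h s0pos v0 by (intro before) (auto simp: r_def)
    ultimately show False using q0 by simp
  qed
  have unit: "0 \<le> v \<bullet> (semigroup L t X *v v)" if v: "norm v = 1" for v
  proof (rule ccontr)
    assume n: "\<not> ?thesis"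
    \<comment> \<open>For this \<open>e\<close> the perturbation at time \<open>t\<close> exactly
      cancels the negative value, so \<open>pos\<close> would say \<open>0 < 0\<close>.\<close>
    then show False
      using pos[of "- (v \<bullet> (semigroup L t X *v v)) / exp (c * t)" v] v by (simp add: divide_neg_pos)
  qed
  show ?thesis unfolding psd_def
  proof
    fix w
    show "0 \<le> w \<bullet> (semigroup L t X *v w)"
    proof (cases "w = 0")
      case False
      have "0 \<le> (norm w)\<^sup>2 * (sgn w \<bullet> (semigroup L t X *v sgn w))"
        using unit[of "sgn w"] False by (simp add: norm_sgn)
      also have "\<dots> = w \<bullet> (semigroup L t X *v w)"
        using False by (simp add: sgn_div_norm mv.scaleR_right power2_eq_square field_simps)
      finally show ?thesis .
    qed simp
  qed
qed

section \<open>Stability of a dark state\<close>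

lemma linear_lindblad: "linear (lindblad M D)"
  unfolding lindblad_def
  by (rule linearI)
    (simp_all add: mm.add_left mm.add_right mm.scaleR_left mm.scaleR_right scaleR_add_right
      sum.distrib sum_subtractf scaleR_sum_right algebra_simps)

lemma lindblad_adj: "adj (lindblad M D X) = lindblad M D (adj X)"
  by (simp add: lindblad_def adj_simps adj_mult matrix_mul_assoc add.commute)

lemma trace_lindblad: "trace (lindblad M D X) = 0"
proof -
  have "trace (D k ** X ** adj (D k)) = trace (adj (D k) ** D k ** X)" for k
    using trace_mult_commute[of "D k ** X" "adj (D k)"] by (simp add: matrix_mul_assoc)
  moreover have "trace (X ** (adj (D k) ** D k)) = trace (adj (D k) ** D k ** X)" for k
    by (rule trace_mult_commute)
  ultimately show ?thesis
    by (simp add: lindblad_def trace_simps scaleR_conv_of_real[where 'a = complex])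
qed

lemma inner_adj_left: "u \<bullet> (A *v w) = (adj A *v u) \<bullet> w"
  using inner_adj[of u "adj A" w] by simp

lemma inner_lindblad:
  "v \<bullet> (lindblad M D X *v v) = (\<Sum>k<M. (adj (D k) *v v) \<bullet> (X *v (adj (D k) *v v))
     - ((adj (D k) *v (D k *v v)) \<bullet> (X *v v) + v \<bullet> (X *v (adj (D k) *v (D k *v v)))) / 2)"
  by (simp add: lindblad_def mv.sum_left mv.diff_left mv.add_left mv.scaleR_left inner_sum_right
      inner_diff_right inner_add_right inner_adj_left[of _ "D _"] inner_adj
      flip: matrix_vector_mul_assoc)

text \<open>A zero of a nonnegative form is a minimum, so the first variation vanishes. Both cross
  terms appear because \<open>psd\<close> does not include self-adjointness.\<close>

lemma psd_null_direction:
  assumes "psd X" "v \<bullet> (X *v v) = 0"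
  shows "w \<bullet> (X *v v) + v \<bullet> (X *v w) = 0"
proof (rule ccontr)
  define b c where "b = w \<bullet> (X *v v) + v \<bullet> (X *v w)" and "c = w \<bullet> (X *v w)"
  assume "\<not> ?thesis"
  then have b: "b \<noteq> 0" by (simp add: b_def)
  have c: "0 \<le> c" using assms by (simp add: psd_def c_def)
  \<comment> \<open>The denominator \<open>c + 1\<close> covers \<open>c = 0\<close> and still makes
    the form negative.\<close>
  define s where "s = - b / (c + 1)"
  have "0 \<le> (v + s *\<^sub>R w) \<bullet> (X *v (v + s *\<^sub>R w))"
    using assms by (simp add: psd_def)
  also have "\<dots> = s * b + s\<^sup>2 * c"
    using assms(2)
    by (simp add: b_def c_def mv.add_right mv.scaleR_right inner_add_left inner_add_right
        power2_eq_square algebra_simps)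
  also have "\<dots> = - (b / (c + 1))\<^sup>2"
    using c by (simp add: s_def power2_eq_square divide_simps) (simp add: algebra_simps)
  finally show False using b c by simp
qed

text \<open>In a null direction the anticommutator contributes nothing, by
  \<open>psd_null_direction\<close>. The remaining gain term is nonnegative, which is the
  quasi-positivity that \<open>semigroup_psd\<close> asks for.\<close>

lemma lindblad_psd:
  assumes "psd X" "0 \<le> t"
  shows "psd (semigroup (lindblad M D) t X)"
proof (rule semigroup_psd[OF linear_lindblad _ assms])
  fix X :: "'a op" and v
  assume "psd X" "v \<bullet> (X *v v) = 0"
  then show "0 \<le> v \<bullet> (lindblad M D X *v v)"
    by (simp add: inner_lindblad psd_null_direction) (simp add: psd_def sum_nonneg)
qed

text \<open>For an orthogonal projector \<open>P\<close>, the real-linear projection of all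
  operators onto the self-adjoint ones supported in \<open>P\<close>. It lets the restricted
  generator be studied on the whole space.\<close>

definition compress :: "'h::finite op \<Rightarrow> 'h op \<Rightarrow> 'h op" where
  "compress P X = (1/2 :: real) *\<^sub>R (P ** X ** P + P ** adj X ** P)"

text \<open>Regularization of a generator \<open>L\<close>: on the self-adjoint operators supported in \<open>P\<close> the
  stationary target is moved from eigenvalue \<open>0\<close> to \<open>1\<close>; on a complement it is the identity.\<close>

definition regularized :: "'h::finite op \<Rightarrow> complex^'h \<Rightarrow> ('h op \<Rightarrow> 'h op) \<Rightarrow> 'h op \<Rightarrow> 'h op" where
  "regularized P \<Psi> L X =
     L (compress P X) + Re (trace (compress P X)) *\<^sub>R ket_bra \<Psi> \<Psi> + (X - compress P X)"

lemma linear_compress: "linear (compress P)"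
  unfolding compress_def
  by (rule linearI) (simp_all add: adj_simps mm.add_left mm.add_right mm.scaleR_left mm.scaleR_right
      algebra_simps)

lemma linear_regularized:
  assumes "linear L"
  shows "linear (regularized P \<Psi> L)"
  unfolding regularized_def
  by (rule linearI)
    (simp_all add: linear_add[OF assms] linear_scale[OF assms] trace_simps
      linear_add[OF linear_compress] linear_scale[OF linear_compress] algebra_simps)

section \<open>Jump operators with a dark target inside an invariant block\<close>

locale dissipative =
  fixes M :: nat and D :: "nat \<Rightarrow> 'h::finite op" and \<Psi> :: "complex^'h" and P :: "'h op"
  assumes norm_Psi: "norm \<Psi> = 1"
    and P_idem: "P ** P = P"
    and P_adj: "adj P = P"
    and P_Psi: "P *v \<Psi> = \<Psi>"
    and D_Psi: "k < M \<Longrightarrow> D k *v \<Psi> = 0"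
    and D_P: "k < M \<Longrightarrow> D k ** P = P ** D k"
begin

abbreviation "\<L> \<equiv> lindblad M D"
abbreviation "\<rho>\<^sub>d \<equiv> ket_bra \<Psi> \<Psi>"

lemma adj_D_P: "k < M \<Longrightarrow> adj (D k) ** P = P ** adj (D k)"
  using arg_cong[OF D_P, of k adj] by (simp add: adj_mult P_adj)

text \<open>\<open>P\<close> commutes with \<open>D k\<close> and, by taking adjoints, with
  \<open>adj (D k)\<close>, so it can be moved through every term.\<close>

lemma lindblad_compress_block: "P ** \<L> X ** P = \<L> (P ** X ** P)"
proof -
  have "P ** (D k ** X ** adj (D k)) ** P = D k ** (P ** X ** P) ** adj (D k)"
    "P ** (adj (D k) ** D k ** X) ** P = adj (D k) ** D k ** (P ** X ** P)"
    "P ** (X ** (adj (D k) ** D k)) ** P = P ** X ** P ** (adj (D k) ** D k)" if "k < M" for k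
    using D_P[OF that] adj_D_P[OF that] by (metis matrix_mul_assoc)+
  then show ?thesis
    unfolding lindblad_def mm.sum_left mm.sum_right
    by (intro sum.cong) (simp_all add: mm.diff_left mm.diff_right mm.add_left mm.add_right
        mm.scaleR_left mm.scaleR_right)
qed

lemma compress_lindblad: "compress P (\<L> X) = \<L> (compress P X)"
  by (simp add: compress_def lindblad_adj lindblad_compress_block
      linear_add[OF linear_lindblad] linear_scale[OF linear_lindblad])

lemma compress_self_adjoint: "adj (compress P X) = compress P X"
  by (simp add: compress_def adj_simps adj_mult P_adj matrix_mul_assoc add.commute)

lemma compress_supported: "P ** compress P X ** P = compress P X"
proof -
  have "P ** (P ** Y ** P) ** P = P ** Y ** P" for Y
    by (metis P_idem matrix_mul_assoc)
  then show ?thesis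
    by (simp add: compress_def mm.add_left mm.add_right mm.scaleR_left mm.scaleR_right)
qed

lemma compress_fixed_iff: "compress P X = X \<longleftrightarrow> adj X = X \<and> P ** X ** P = X"
proof
  show "adj X = X \<and> P ** X ** P = X" if "compress P X = X"
    using that compress_self_adjoint[of X] compress_supported[of X] by simp
  show "compress P X = X" if "adj X = X \<and> P ** X ** P = X"
    using that by (simp add: compress_def flip: scaleR_add_left)
qed

lemma compress_idem: "compress P (compress P X) = compress P X"
  by (simp add: compress_fixed_iff compress_self_adjoint compress_supported)

lemma compress_target: "compress P \<rho>\<^sub>d = \<rho>\<^sub>d"
  by (simp add: compress_fixed_iff adj_ket_bra mult_ket_bra ket_bra_mult P_adj P_Psi)

lemma lindblad_target: "\<L> \<rho>\<^sub>d = 0"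
  unfolding lindblad_def
  by (intro sum.neutral)
    (simp add: mult_ket_bra ket_bra_mult adj_mult D_Psi mv.zero_right flip: matrix_vector_mul_assoc)

lemma trace_target: "Re (trace \<rho>\<^sub>d) = 1"
  by (simp add: trace_ket_bra norm_Psi)

lemma fidelity_target: "\<Psi> \<bullet> (\<rho>\<^sub>d *v \<Psi>) = 1"
  using inner_ket_bra[of "\<rho>\<^sub>d" \<Psi>] by (simp add: dot_square_norm norm_ket_bra norm_Psi)

lemma regularized_target: "regularized P \<Psi> \<L> \<rho>\<^sub>d = \<rho>\<^sub>d"
  by (simp add: regularized_def compress_target lindblad_target trace_target)

lemma regularized_lindblad:
  "compress P X = X \<Longrightarrow> regularized P \<Psi> \<L> X = \<L> X + Re (trace X) *\<^sub>R \<rho>\<^sub>d"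
  by (simp add: regularized_def)

text \<open>As \<open>D k\<close> annihilates the target, only the gain term remains. This is why
  the fidelity never decreases along trajectories of states.\<close>

lemma inner_lindblad_target: "psd X \<Longrightarrow> 0 \<le> \<Psi> \<bullet> (\<L> X *v \<Psi>)"
  unfolding inner_lindblad by (intro sum_nonneg) (simp add: D_Psi mv.zero_right psd_def)

text \<open>Being fixed by \<open>compress P\<close> encodes self-adjointness and support at once,
  and is preserved because \<open>compress P\<close> commutes with the generator.\<close>

lemma semigroup_density:
  assumes "\<rho> \<in> density_in P" "0 \<le> t"
  shows "semigroup \<L> t \<rho> \<in> density_in P"
  using assms
    semigroup_commute[OF linear_lindblad linear_compress compress_lindblad, where t = t and X = \<rho>]
    semigroup_invariant[OF linear_lindblad linear_trace trace_lindblad, where t = t and X = \<rho>]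
  by (metis compress_fixed_iff density_in_iff lindblad_psd)

lemma norm_density_le: "\<rho> \<in> density_in P \<Longrightarrow> norm \<rho> \<le> 1"
  using norm_le_trace[of \<rho>] by (simp add: density_in_iff)

lemma dist_target_le:
  assumes "\<rho> \<in> density_in P"
  shows "(norm (\<rho> - \<rho>\<^sub>d))\<^sup>2 \<le> 2 * (1 - \<Psi> \<bullet> (\<rho> *v \<Psi>))"
proof -
  have "(norm (\<rho> - \<rho>\<^sub>d))\<^sup>2 = (norm \<rho>)\<^sup>2 + 1 - 2 * (\<Psi> \<bullet> (\<rho> *v \<Psi>))"
    using dot_norm_neg[of \<rho> "\<rho>\<^sub>d"] by (simp add: inner_ket_bra norm_ket_bra norm_Psi)
  moreover have "(norm \<rho>)\<^sup>2 \<le> 1"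
    using norm_density_le[OF assms] by (simp add: power_le_one)
  ultimately show ?thesis by simp
qed

lemma inj_regularized_imp_stable:
  assumes inj: "inj (regularized P \<Psi> \<L>)"
  shows "cond_as_stable \<L> \<Psi> P"
  unfolding cond_as_stable_def
proof
  fix \<rho>0 assume \<rho>0: "\<rho>0 \<in> density_in P"
  define \<rho> where "\<rho> = (\<lambda>t. semigroup \<L> t \<rho>0)"
  have dens: "\<rho> t \<in> density_in P" if "0 \<le> t" for t
    using semigroup_density[OF \<rho>0 that] by (simp add: \<rho>_def)
  note lin = linear_regularized[OF linear_lindblad, of P \<Psi> M D]
  obtain S where S: "linear S" "\<And>X. S (regularized P \<Psi> \<L> X) = X"
    using linear_injective_isomorphism[OF lin inj] by blast
  define F where "F = (\<lambda>X. \<Psi> \<bullet> (X *v \<Psi>))"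
  have lF: "linear F"
    by (rule linearI) (simp_all add: F_def mv.add_left mv.scaleR_left inner_add_right)
  \<comment> \<open>\<open>S\<close> recovers \<open>X\<close> minus the target from
    \<open>lindblad M D X\<close> when \<open>X\<close> is a state. So \<open>f\<close> gives the
    trace minus the fidelity of that traceless difference, namely the infidelity of
    \<open>X\<close>.\<close>
  define f where "f = (\<lambda>X. Re (trace (S X)) - F (S X))"
  have lf: "linear f"
    by (rule linearI)
      (simp_all add: f_def linear_add[OF lF] linear_scale[OF lF] linear_add[OF S(1)]
        linear_scale[OF S(1)] trace_simps algebra_simps)
  have fL: "f (\<L> X) = 1 - F X" if X: "X \<in> density_in P" for X
  proof -
    have "compress P X = X" "trace X = 1" using X by (simp_all add: compress_fixed_iff density_in_iff)
    then have "regularized P \<Psi> \<L> (X - \<rho>\<^sub>d) = \<L> X"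
      by (simp add: linear_diff[OF lin] regularized_lindblad regularized_target)
    then have "S (\<L> X) = X - \<rho>\<^sub>d" using S(2) by metis
    moreover have "F \<rho>\<^sub>d = 1" by (simp add: F_def fidelity_target)
    ultimately show ?thesis
      using \<open>trace X = 1\<close> by (simp add: f_def trace_simps linear_diff[OF lF] trace_target)
  qed
  obtain K where K: "K > 0" "\<And>X. norm (f X) \<le> K * norm X"
    using linear_bounded_pos[OF lf] by blast
  have bound: "1 - F (\<rho> t) \<le> 2 * K / t" if t: "0 < t" for t
  proof -
    have "((\<lambda>t. f (\<rho> t)) has_real_derivative f (\<L> (\<rho> s))) (at s)" for s
      unfolding \<rho>_def by (rule DERIV_semigroup[OF linear_lindblad lf])
    \<comment> \<open>The mean value theorem expresses the growth of \<open>f\<close> as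
      \<open>t\<close> times the infidelity at an intermediate \<open>s\<close>; monotone fidelity
      transfers the bound to time \<open>t\<close>.\<close>
    from MVT2[OF t this] obtain s
      where s: "0 < s" "s < t" "f (\<rho> t) - f (\<rho> 0) = (t - 0) * f (\<L> (\<rho> s))"
      by blast
    have "F (\<rho> s) \<le> F (\<rho> t)"
    proof (rule DERIV_nonneg_imp_nondecreasing[where f = "\<lambda>t. F (\<rho> t)"])
      fix x assume "s \<le> x" "x \<le> t"
      then have "0 \<le> F (\<L> (\<rho> x))"
        using dens[of x] s by (simp add: F_def density_in_iff inner_lindblad_target)
      moreover have "((\<lambda>t. F (\<rho> t)) has_real_derivative F (\<L> (\<rho> x))) (at x)"
        unfolding \<rho>_def by (rule DERIV_semigroup[OF linear_lindblad lF])
      ultimately show "\<exists>y. ((\<lambda>t. F (\<rho> t)) has_real_derivative y) (at x) \<and> 0 \<le> y" by blast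
    qed (use s in simp)
    then have "t * (1 - F (\<rho> t)) \<le> t * (1 - F (\<rho> s))" using t by simp
    also have "\<dots> = f (\<rho> t) - f (\<rho> 0)"
      using s dens[of s] by (simp add: fL)
    also have "\<dots> \<le> 2 * K"
    proof -
      \<comment> \<open>States have norm at most \<open>1\<close>, so \<open>K\<close> bounds
        \<open>f\<close> at both endpoints; this gives the factor \<open>2\<close>.\<close>
      have "\<bar>f (\<rho> r)\<bar> \<le> K" if "0 \<le> r" for r
      proof -
        have "\<bar>f (\<rho> r)\<bar> \<le> K * norm (\<rho> r)" using K(2)[of "\<rho> r"] by simp
        also have "\<dots> \<le> K * 1"
          using K(1) norm_density_le[OF dens[OF that]] by (intro mult_left_mono) auto
        finally show ?thesis by simp
      qed
      from this[of t] this[of 0] t show ?thesis by simp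
    qed
    finally show ?thesis using t by (simp add: field_simps)
  qed
  have "((\<lambda>t. (norm (\<rho> t - \<rho>\<^sub>d))\<^sup>2) \<longlongrightarrow> 0) at_top"
  proof (rule tendsto_sandwich[where f = "\<lambda>_. 0"])
    show "\<forall>\<^sub>F t in at_top. (norm (\<rho> t - \<rho>\<^sub>d))\<^sup>2 \<le> 2 * (2 * K / t)"
      using eventually_gt_at_top[of 0]
    proof eventually_elim
      case (elim t)
      then show ?case using bound[of t] dist_target_le[OF dens[of t]] by (simp add: F_def)
    qed
    show "((\<lambda>t. 2 * (2 * K / t)) \<longlongrightarrow> 0) at_top"
      by (intro tendsto_mult_right_zero tendsto_divide_0[OF tendsto_const] filterlim_at_top_imp_at_infinity
          filterlim_ident)
  qed auto
  then have "((\<lambda>t. norm (\<rho> t - \<rho>\<^sub>d)) \<longlongrightarrow> 0) at_top"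
    using tendsto_real_sqrt by fastforce
  then show "((\<lambda>t. semigroup \<L> t \<rho>0) \<longlongrightarrow> \<rho>\<^sub>d) at_top"
    unfolding \<rho>_def by (simp add: tendsto_norm_zero_iff LIM_zero_cancel)
qed

lemma inner_P: "v \<bullet> (P *v v) = (norm (P *v v))\<^sup>2"
  by (metis P_adj P_idem inner_adj dot_square_norm matrix_vector_mul_assoc)

text \<open>\<open>Z\<close> is a multiple of the difference of two density operators. Both evolve
  to the target, so the evolved difference tends to zero; but \<open>Z\<close> is stationary, so it
  is constant and hence zero.\<close>

lemma stable_kernel:
  assumes stable: "cond_as_stable \<L> \<Psi> P"
    and Z: "adj Z = Z" "P ** Z ** P = Z" and tr0: "Re (trace Z) = 0" and LZ: "\<L> Z = 0"
  shows "Z = 0"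
proof -
  obtain K where K: "K > 0" "\<And>v. norm (Z *v v) \<le> norm v * K"
    using bounded_linear.pos_bounded[OF mv.bounded_linear_right] by blast
  have trZ: "trace Z = 0"
    using trace_adj[of Z] tr0 by (simp add: Z complex_eq_iff)
  have psdP: "psd P" by (simp add: psd_def inner_P)
  define p where "p = Re (trace P)"
  have "P \<noteq> 0" using P_Psi norm_Psi by auto
  then have p: "p > 0"
    using norm_le_trace[OF P_adj psdP] by (simp add: p_def) (metis less_le_trans zero_less_norm_iff)
  have trP: "trace P = of_real p"
    using trace_adj[of P] by (simp add: p_def P_adj complex_eq_iff)
  \<comment> \<open>\<open>K\<close> bounds the operator norm of \<open>Z\<close>, so the shift by
    \<open>K\<close> times \<open>P\<close> makes the operator positive; its trace is
    \<open>K * p\<close>.\<close>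
  define A where "A = Z + K *\<^sub>R P"
  have "psd A"
    unfolding psd_def
  proof
    fix v
    have "v \<bullet> (Z *v v) = (P *v v) \<bullet> (Z *v (P *v v))"
      by (metis P_adj Z(2) inner_adj matrix_vector_mul_assoc)
    moreover have "- ((P *v v) \<bullet> (Z *v (P *v v))) \<le> norm (P *v v) * (norm (P *v v) * K)"
      using Cauchy_Schwarz_ineq2[of "P *v v" "Z *v (P *v v)"] mult_left_mono[OF K(2)[of "P *v v"]]
      by (smt (verit) norm_ge_zero)
    ultimately show "0 \<le> v \<bullet> (A *v v)"
      by (simp add: A_def mv.add_left mv.scaleR_left inner_add_right inner_P power2_eq_square
          algebra_simps)
  qed
  then have 1: "(1 / (K * p)) *\<^sub>R A \<in> density_in P"
    using K p
    by (simp add: density_in_iff A_def psd_def mv.scaleR_left adj_simps Z P_adj trace_simps trZ trP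
        mm.add_left mm.add_right mm.scaleR_left mm.scaleR_right P_idem scaleR_conv_of_real[where 'a = complex])
  have 2: "(1 / p) *\<^sub>R P \<in> density_in P"
    using p psdP
    by (simp add: density_in_iff psd_def mv.scaleR_left adj_simps P_adj trace_simps trP
        mm.scaleR_left mm.scaleR_right P_idem scaleR_conv_of_real[where 'a = complex])
  have d: "(1 / (K * p)) *\<^sub>R A - (1 / p) *\<^sub>R P = (1 / (K * p)) *\<^sub>R Z"
    using K by (simp add: A_def algebra_simps)
  have "((\<lambda>t. semigroup \<L> t ((1 / (K * p)) *\<^sub>R A) - semigroup \<L> t ((1 / p) *\<^sub>R P)) \<longlongrightarrow> \<rho>\<^sub>d - \<rho>\<^sub>d) at_top"
    using stable 1 2 unfolding cond_as_stable_def by (intro tendsto_diff) auto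
  moreover have "semigroup \<L> t ((1 / (K * p)) *\<^sub>R A) - semigroup \<L> t ((1 / p) *\<^sub>R P) = (1 / (K * p)) *\<^sub>R Z" for t
    using linear_diff[OF linear_semigroup[OF linear_lindblad[of M D], of t],
        of "(1 / (K * p)) *\<^sub>R A" "(1 / p) *\<^sub>R P"]
    by (simp only: d linear_scale[OF linear_semigroup[OF linear_lindblad], of _ _ _ _ Z]
        semigroup_kernel[OF linear_lindblad LZ])
  ultimately have "((\<lambda>t::real. (1 / (K * p)) *\<^sub>R Z) \<longlongrightarrow> 0) at_top" by simp
  then have "(1 / (K * p)) *\<^sub>R Z = 0" by (simp add: tendsto_const_iff)
  then show "Z = 0" using K p by simp
qed

lemma stable_imp_inj_regularized:
  assumes stable: "cond_as_stable \<L> \<Psi> P"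
  shows "inj (regularized P \<Psi> \<L>)"
  unfolding linear_injective_0[OF linear_regularized[OF linear_lindblad]]
proof (intro allI impI)
  fix X assume X: "regularized P \<Psi> \<L> X = 0"
  define Z r where "Z = compress P X" and "r = Re (trace Z)"
  have Z: "compress P Z = Z" by (simp add: Z_def compress_idem)
  have eq: "\<L> Z + r *\<^sub>R \<rho>\<^sub>d + (X - Z) = 0"
    using X by (simp add: regularized_def Z_def r_def)
  \<comment> \<open>Compressing removes the component \<open>X - Z\<close> and fixes the rest; the
    trace below then isolates \<open>r\<close>, since the image of the generator is
    traceless.\<close>
  have "compress P (\<L> Z + r *\<^sub>R \<rho>\<^sub>d + (X - Z)) = \<L> Z + r *\<^sub>R \<rho>\<^sub>d"
    by (simp add: linear_add[OF linear_compress] linear_diff[OF linear_compress] Z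
        linear_scale[OF linear_compress] compress_lindblad compress_target flip: Z_def)
  then have z: "\<L> Z + r *\<^sub>R \<rho>\<^sub>d = 0" unfolding eq by (simp add: linear_0[OF linear_compress])
  then have "X = Z" using eq by simp
  have "Re (trace (\<L> Z + r *\<^sub>R \<rho>\<^sub>d)) = r"
    using trace_target by (simp add: trace_simps trace_lindblad)
  then have "r = 0" using z by (simp add: linear_0[OF linear_trace])
  then have "Z = 0"
    using stable_kernel[OF stable, of Z] Z z by (simp add: compress_fixed_iff r_def)
  then show "X = 0" using \<open>X = Z\<close> by simp
qed

lemma stable_iff_inj_regularized: "cond_as_stable \<L> \<Psi> P \<longleftrightarrow> inj (regularized P \<Psi> \<L>)"
  using inj_regularized_imp_stable stable_imp_inj_regularized by blast

end

section \<open>Null sets of singular parameters\<close>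

text \<open>Eigenvectors for distinct eigenvalues are independent, so the dimension bounds the
  number of eigenvalues.\<close>

lemma finite_eigenvalues:
  fixes K :: "'a::euclidean_space \<Rightarrow> 'a"
  assumes K: "linear K"
  shows "finite {l. \<exists>v. v \<noteq> 0 \<and> K v = l *\<^sub>R v}"
proof -
  let ?E = "{l. \<exists>v. v \<noteq> 0 \<and> K v = l *\<^sub>R v}"
  obtain w where w: "\<And>l. l \<in> ?E \<Longrightarrow> w l \<noteq> 0 \<and> K (w l) = l *\<^sub>R w l"
    using bchoice[of ?E "\<lambda>l v. v \<noteq> 0 \<and> K v = l *\<^sub>R v"] by auto
  have indep: "(\<Sum>l\<in>S. c l *\<^sub>R w l) = 0 \<Longrightarrow> \<forall>l\<in>S. c l = 0" if "finite S" "S \<subseteq> ?E" for S c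
    using that
  proof (induction S arbitrary: c rule: finite_induct)
    case (insert m S)
    \<comment> \<open>Applying \<open>K\<close> minus \<open>m\<close> to the relation cancels the
      new eigenvector and multiplies each other coefficient by the nonzero number
      \<open>l - m\<close>.\<close>
    have "0 = K (\<Sum>l\<in>insert m S. c l *\<^sub>R w l) - m *\<^sub>R (\<Sum>l\<in>insert m S. c l *\<^sub>R w l)"
      by (simp only: insert.prems linear_0[OF K] scaleR_zero_right diff_self)
    also have "\<dots> = (\<Sum>l\<in>insert m S. (c l * (l - m)) *\<^sub>R w l)"
      unfolding linear_sum[OF K] scaleR_sum_right sum_subtractf[symmetric]
    proof (rule sum.cong)
      fix l assume "l \<in> insert m S"
      then have "K (w l) = l *\<^sub>R w l" using w insert.prems(2) by blast
      then show "K (c l *\<^sub>R w l) - m *\<^sub>R c l *\<^sub>R w l = (c l * (l - m)) *\<^sub>R w l"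
        by (simp add: linear_scale[OF K] algebra_simps)
    qed simp
    also have "\<dots> = (\<Sum>l\<in>S. (c l * (l - m)) *\<^sub>R w l)"
      using insert.hyps by simp
    finally have "\<forall>l\<in>S. c l * (l - m) = 0"
      using insert.IH[of "\<lambda>l. c l * (l - m)"] insert.prems(2) by simp
    then have S: "\<forall>l\<in>S. c l = 0" using insert.hyps by auto
    then have "c m *\<^sub>R w m = 0" using insert.prems(1) insert.hyps by simp
    then show ?case using S w[of m] insert.prems(2) by auto
  qed simp
  have card: "card S \<le> DIM('a)" if S: "finite S" "S \<subseteq> ?E" for S
  proof -
    have inj: "inj_on w S"
    proof (rule inj_onI)
      fix a b assume ab: "a \<in> S" "b \<in> S" "w a = w b"
      then have "w a \<noteq> 0 \<and> K (w a) = a *\<^sub>R w a" "K (w b) = b *\<^sub>R w b" using w S by blast+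
      then show "a = b" using ab(3) by auto
    qed
    have "independent (w ` S)"
    proof (rule independent_if_scalars_zero)
      fix f x assume f: "(\<Sum>x\<in>w ` S. f x *\<^sub>R x) = 0" "x \<in> w ` S"
      then show "f x = 0" using indep[OF S, of "\<lambda>l. f (w l)"] by (auto simp: sum.reindex[OF inj])
    qed (use S in simp)
    then show ?thesis using independent_bound[of "w ` S"] card_image[OF inj] by simp
  qed
  show ?thesis
  proof (rule ccontr)
    assume "infinite ?E"
    then obtain S where "S \<subseteq> ?E" "finite S" "card S = Suc DIM('a)"
      using infinite_arbitrarily_large by blast
    then show False using card[of S] by simp
  qed
qed

text \<open>If \<open>(A + t B + t\<^sup>2 C) X = 0\<close>, then \<open>(X, t X)\<close> is an eigenvector of the companion operator for
  the eigenvalue \<open>1 / t\<close>.\<close>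

lemma finite_singular_quadratic_pencil:
  fixes A B C :: "'a::euclidean_space \<Rightarrow> 'a"
  assumes lin: "linear A" "linear B" "linear C" and inj: "inj A"
  shows "finite {t. \<exists>X. X \<noteq> 0 \<and> A X + t *\<^sub>R B X + t\<^sup>2 *\<^sub>R C X = 0}" (is "finite ?Z")
proof -
  obtain S where S: "linear S" "\<And>X. S (A X) = X"
    using linear_injective_isomorphism[OF lin(1) inj] by blast
  define K where "K = (\<lambda>z. (- S (B (fst z) + C (snd z)), fst z))"
  have "linear K"
    by (rule linearI)
      (simp_all add: K_def linear_add[OF S(1)] linear_add[OF lin(2)] linear_add[OF lin(3)]
        linear_scale[OF S(1)] linear_scale[OF lin(2)] linear_scale[OF lin(3)] algebra_simps
        flip: scaleR_add_right)
  then have "finite (inverse ` {l. \<exists>v. v \<noteq> 0 \<and> K v = l *\<^sub>R v})"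
    by (intro finite_imageI finite_eigenvalues)
  moreover have "?Z \<subseteq> inverse ` {l. \<exists>v. v \<noteq> 0 \<and> K v = l *\<^sub>R v}"
  proof
    fix t assume "t \<in> ?Z"
    then obtain X where X: "X \<noteq> 0" "A X + t *\<^sub>R B X + t\<^sup>2 *\<^sub>R C X = 0" by blast
    have "t \<noteq> 0"
    proof
      assume "t = 0"
      then have "A X = 0" using X by simp
      then show False using X S(2)[of X] linear_0[OF S(1)] by simp
    qed
    have "A X + t *\<^sub>R (B X + C (t *\<^sub>R X)) = 0"
      using X(2) by (simp add: linear_scale[OF lin(3)] power2_eq_square algebra_simps)
    then have "S (A X + t *\<^sub>R (B X + C (t *\<^sub>R X))) = 0" by (simp add: linear_0[OF S(1)])
    then have "X + t *\<^sub>R S (B X + C (t *\<^sub>R X)) = 0"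
      by (simp add: linear_add[OF S(1)] linear_scale[OF S(1)] S(2))
    then have "(1 / t) *\<^sub>R (X + t *\<^sub>R S (B X + C (t *\<^sub>R X))) = 0" by simp
    then have "- S (B X + C (t *\<^sub>R X)) = (1 / t) *\<^sub>R X"
      using \<open>t \<noteq> 0\<close> by (simp add: scaleR_add_right neg_eq_iff_add_eq_0 add.commute)
    then have "K (X, t *\<^sub>R X) = (1 / t) *\<^sub>R (X, t *\<^sub>R X)"
      using \<open>t \<noteq> 0\<close> by (simp add: K_def)
    moreover have "(X, t *\<^sub>R X) \<noteq> 0" using X by (simp add: zero_prod_def)
    ultimately have "1 / t \<in> {l. \<exists>v. v \<noteq> 0 \<and> K v = l *\<^sub>R v}" by blast
    then show "t \<in> inverse ` {l. \<exists>v. v \<noteq> 0 \<and> K v = l *\<^sub>R v}"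
      by (rule rev_image_eqI) (simp add: inverse_eq_divide)
  qed
  ultimately show ?thesis by (rule finite_subset[rotated])
qed

text \<open>Fubini over pairs of a direction and a parameter: for some \<open>t \<noteq> 0\<close>
  almost no direction \<open>x\<close> has \<open>x0 + t *\<^sub>R x\<close> in \<open>Z\<close>. An
  invertible affine map carries this null set of directions onto \<open>Z\<close>.\<close>

lemma closed_null_if_null_on_lines:
  fixes Z :: "'a::euclidean_space set"
  assumes Z: "closed Z" and lines: "\<And>v. countable {t. x0 + t *\<^sub>R v \<in> Z}"
  shows "Z \<in> null_sets lborel"
proof -
  define Q where "Q = (\<lambda>z :: 'a \<times> real. x0 + snd z *\<^sub>R fst z) -` Z"
  have "closed Q"
    unfolding Q_def by (intro closed_vimage Z continuous_intros)
  then have Q: "Q \<in> sets (lborel \<Otimes>\<^sub>M lborel)"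
    by (simp only: lborel_prod sets_lborel borel_closed)
  have "AE x in lborel. AE t in lborel. (x, t) \<notin> Q"
  proof (rule AE_I2)
    fix x :: 'a
    have "{t. (x, t) \<in> Q} \<in> null_sets lborel"
      using lines[of x] by (intro countable_imp_null_set_lborel) (simp add: Q_def)
    then show "AE t in lborel. (x, t) \<notin> Q" by (rule AE_I') auto
  qed
  then have "AE t in lborel. AE x in lborel. (x, t) \<notin> Q"
  proof (rule lborel_pair.AE_commute[THEN iffD1, rotated])
    have "{z. z \<notin> Q} = UNIV - Q" by auto
    then show "{z \<in> space (lborel \<Otimes>\<^sub>M lborel). (fst z, snd z) \<notin> Q} \<in> sets (lborel \<Otimes>\<^sub>M lborel)"
      using sets.compl_sets[OF Q] by (simp add: space_pair_measure)
  qed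
  \<comment> \<open>Excluding \<open>t = 0\<close> keeps the affine map invertible; at
    \<open>0\<close> the whole space collapses to \<open>x0\<close>.\<close>
  moreover have "AE t in lborel. t \<noteq> (0::real)" by (rule AE_lborel_singleton)
  ultimately have ae: "AE t in lborel. t \<noteq> 0 \<and> (AE x in lborel. (x, t) \<notin> Q)" by auto
  have "ae_filter (lborel :: real measure) \<noteq> bot" by (simp add: ae_filter_eq_bot_iff)
  from eventually_happens'[OF this ae] obtain t :: real
    where t: "t \<noteq> 0" "AE x in lborel. (x, t) \<notin> Q"
    by blast
  define S where "S = {x. x0 + t *\<^sub>R x \<in> Z}"
  have "closed S"
    unfolding S_def vimage_def[symmetric, of _ Z]
    by (intro closed_vimage[unfolded vimage_def] Z continuous_intros)
  then have "S \<in> null_sets lborel"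
    using t(2) by (simp add: S_def Q_def AE_iff_null_sets borel_closed)
  then have "negligible S"
    by (simp add: negligible_iff_null_sets null_sets_completionI)
  then have "negligible ((\<lambda>x. x0 + t *\<^sub>R x) ` S)"
    by (rule negligible_differentiable_image_negligible[OF order_refl])
      (auto intro!: derivative_intros)
  moreover have "(\<lambda>x. x0 + t *\<^sub>R x) ` S = Z"
  proof
    show "Z \<subseteq> (\<lambda>x. x0 + t *\<^sub>R x) ` S"
    proof
      fix z assume "z \<in> Z"
      then show "z \<in> (\<lambda>x. x0 + t *\<^sub>R x) ` S"
        using t(1) by (intro image_eqI[of _ _ "(1 / t) *\<^sub>R (z - x0)"]) (simp_all add: S_def)
    qed
  qed (auto simp: S_def)
  ultimately show ?thesis
    using Z by (simp add: negligible_iff_null_sets null_sets_completion_iff borel_closed)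
qed

section \<open>Dependence of the generator on the parameters\<close>

definition lindblad_mixed ::
    "nat \<Rightarrow> (nat \<Rightarrow> 'h::finite op) \<Rightarrow> (nat \<Rightarrow> 'h op) \<Rightarrow> 'h op \<Rightarrow> 'h op" where
  "lindblad_mixed M D E X = (\<Sum>k<M. D k ** X ** adj (E k) + E k ** X ** adj (D k)
     - (1/2 :: real) *\<^sub>R ((adj (D k) ** E k + adj (E k) ** D k) ** X
         + X ** (adj (D k) ** E k + adj (E k) ** D k)))"

lemma linear_lindblad_mixed: "linear (lindblad_mixed M D E)"
  unfolding lindblad_mixed_def
  by (rule linearI)
    (simp_all add: mm.add_left mm.add_right mm.scaleR_left mm.scaleR_right scaleR_add_right
      sum.distrib sum_subtractf scaleR_sum_right algebra_simps)

text \<open>\<open>lindblad\<close> is quadratic in the jump operators, and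
  \<open>lindblad_mixed\<close> is its polarization.\<close>

lemma lindblad_line:
  "lindblad M (\<lambda>k. D k + t *\<^sub>R E k) X
     = lindblad M D X + t *\<^sub>R lindblad_mixed M D E X + t\<^sup>2 *\<^sub>R lindblad M E X"
  unfolding lindblad_def lindblad_mixed_def scaleR_sum_right sum.distrib[symmetric]
  by (rule sum.cong)
    (simp_all add: adj_simps mm.add_left mm.add_right mm.scaleR_left mm.scaleR_right scaleR_add_right
      scaleR_diff_right power2_eq_square matrix_mul_assoc algebra_simps)

lemma continuous_on_adj [continuous_intros]:
  "continuous_on S f \<Longrightarrow> continuous_on S (\<lambda>x. adj (f x :: 'h::finite op))"
  by (rule bounded_linear.continuous_on[OF linear_conv_bounded_linear[THEN iffD1, OF linear_adj]])

lemma continuous_on_trace [continuous_intros]: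
  "continuous_on S f \<Longrightarrow> continuous_on S (\<lambda>x. trace (f x :: 'h::finite op))"
  by (rule bounded_linear.continuous_on[OF linear_conv_bounded_linear[THEN iffD1, OF linear_trace]])

lemma continuous_on_lindblad [continuous_intros]:
  assumes "\<And>k. k < M \<Longrightarrow> continuous_on S (\<lambda>x. D x k)" "continuous_on S f"
  shows "continuous_on S (\<lambda>x. lindblad M (D x) (f x :: 'h::finite op))"
  unfolding lindblad_def
  by (intro continuous_intros mm.continuous_on assms) auto

lemma null_set_singular_regularized:
  fixes D :: "'d::euclidean_space \<Rightarrow> nat \<Rightarrow> 'h::finite op"
  assumes lin: "\<And>k. k < M \<Longrightarrow> linear (\<lambda>x. D x k)"
    and inj: "inj (regularized P \<Psi> (lindblad M (D x0)))"
  shows "{x. \<not> inj (regularized P \<Psi> (lindblad M (D x)))} \<in> null_sets lborel"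
    (is "?Z \<in> _")
proof (rule closed_null_if_null_on_lines[where ?x0.0 = x0])
  define R where "R = (\<lambda>x. regularized P \<Psi> (lindblad M (D x)))"
  have linR: "linear (R x)" for x
    unfolding R_def by (rule linear_regularized[OF linear_lindblad])
  have sing: "?Z = {x. \<exists>X. X \<noteq> 0 \<and> R x X = 0}"
    using linear_injective_0[OF linR] by (auto simp: R_def)
  \<comment> \<open>Scaling kernel vectors to norm \<open>1\<close> presents the singular set as the
    projection of a closed set along a compact factor, hence as closed.\<close>
  also have "\<dots> = {x. \<exists>X. X \<in> sphere 0 1 \<and> (X, x) \<in> {z. R (snd z) (fst z) = 0}}"
  proof -
    have "\<exists>X. norm X = 1 \<and> R x X = 0" if "X \<noteq> 0" "R x X = 0" for x X
      using that by (intro exI[of _ "sgn X"]) (simp add: norm_sgn sgn_div_norm linear_scale[OF linR])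
    then have "(\<exists>X. X \<noteq> 0 \<and> R x X = 0) \<longleftrightarrow> (\<exists>X. norm X = 1 \<and> R x X = 0)" for x
      by (metis norm_zero zero_neq_one)
    then show ?thesis by simp
  qed
  finally have Z: "?Z = \<dots>" .
  have cD: "k < M \<Longrightarrow> continuous_on S (\<lambda>z. D (snd z) k)" for k and S :: "('h op \<times> 'd) set"
    by (intro linear_continuous_on_compose[OF _ lin] continuous_intros)
  have "closed {z :: 'h op \<times> 'd. R (snd z) (fst z) = 0}"
    unfolding R_def regularized_def compress_def
    by (intro closed_Collect_eq continuous_intros cD mm.continuous_on)
  then show "closed ?Z"
    unfolding Z by (intro closed_compact_projection compact_sphere)
  fix v
  \<comment> \<open>\<open>B\<close> and \<open>C\<close> collect the terms linear and quadratic in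
    \<open>t\<close>. Only the generator depends on the parameters, so the trace and complement
    parts stay in the constant term.\<close>
  define B where "B = (\<lambda>X. lindblad_mixed M (D x0) (D v) (compress P X))"
  define C where "C = (\<lambda>X. lindblad M (D v) (compress P X))"
  have lB: "linear B" and lC: "linear C"
    using linear_compose[OF linear_compress linear_lindblad_mixed]
      linear_compose[OF linear_compress linear_lindblad] by (simp_all add: B_def C_def o_def)
  have "R (x0 + t *\<^sub>R v) X = R x0 X + t *\<^sub>R B X + t\<^sup>2 *\<^sub>R C X" for t X
  proof -
    have "lindblad M (D (x0 + t *\<^sub>R v)) Y = lindblad M (\<lambda>k. D x0 k + t *\<^sub>R D v k) Y" for Y
      unfolding lindblad_def by (intro sum.cong) (simp_all add: linear_add[OF lin] linear_scale[OF lin])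
    then show ?thesis by (simp add: R_def regularized_def B_def C_def lindblad_line)
  qed
  then have "{t. x0 + t *\<^sub>R v \<in> ?Z} = {t. \<exists>X. X \<noteq> 0 \<and> R x0 X + t *\<^sub>R B X + t\<^sup>2 *\<^sub>R C X = 0}"
    unfolding sing by simp
  moreover have "finite \<dots>"
    using finite_singular_quadratic_pencil[OF linR lB lC] inj by (simp add: R_def)
  ultimately show "countable {t. x0 + t *\<^sub>R v \<in> ?Z}" by (simp add: countable_finite)
qed

text \<open>Lebesgue measure on \<open>W\<close> is read off through the linear bijection
  \<open>f\<close> from a Euclidean space; another choice differs by a linear isomorphism, which
  preserves null sets. Failure of stability is shown to be null in all of \<open>W\<close>
  first.\<close>

theorem theorem4:
  fixes n :: nat and d :: "nat \<Rightarrow> nat" and enc :: "'h::finite \<Rightarrow> nat \<Rightarrow> nat"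
    and M :: nat and N :: "nat \<Rightarrow> nat set"
    and J :: "nat \<Rightarrow> nat" and \<sigma> :: "nat \<Rightarrow> nat \<Rightarrow> 'h op"
    and \<Psi> :: "complex^'h" and P :: "'h op" and \<gamma> :: real
    and f :: "'d::euclidean_space \<Rightarrow> nat \<Rightarrow> nat \<Rightarrow> real"
  assumes dims: "\<forall>a<n. d a > 0"
    and enc: "bij_betw enc UNIV (cfgs n d)"
    and nbhd: "\<forall>k<M. N k \<subseteq> {..<n}"
    and basis: "\<forall>k<M. inj_on (\<lambda>j. \<sigma> j k) {..<J k}
                   \<and> independent ((\<lambda>j. \<sigma> j k) ` {..<J k})
                   \<and> span ((\<lambda>j. \<sigma> j k) ` {..<J k}) = local_ops enc (N k)"
    and Psi: "norm \<Psi> = 1"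
    and proj: "P ** P = P" "adj P = P"
    and Hd_sub: "P *v \<Psi> = \<Psi>"
    and proper: "P \<noteq> mat 1"
    and gamma: "\<gamma> > 0"
    and exists: "\<exists>\<beta>\<in>Wset M J \<sigma> \<Psi> P.
                   cond_as_stable (lindblad M (Dk J \<sigma> \<beta>)) \<Psi> P"
    and f_lin: "\<forall>j k. linear (\<lambda>x. f x j k)"
    and f_inj: "inj f"
    and f_range: "range f = Wset M J \<sigma> \<Psi> P"
  shows "{x. f x \<in> cube \<gamma> \<and>
             \<not> cond_as_stable (lindblad M (Dk J \<sigma> (f x))) \<Psi> P} \<in> null_sets lborel"
proof -
  have W: "dissipative M (Dk J \<sigma> (f x)) \<Psi> P" for x
  proof -
    have "f x \<in> Wset M J \<sigma> \<Psi> P" using f_range by blast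
    then show ?thesis by unfold_locales (simp_all add: Wset_def Psi proj Hd_sub)
  qed
  note stable_iff = dissipative.stable_iff_inj_regularized[OF W]
  obtain x0 where "cond_as_stable (lindblad M (Dk J \<sigma> (f x0))) \<Psi> P"
    using exists f_range by (metis rangeE)
  moreover have "linear (\<lambda>x. Dk J \<sigma> (f x) k)" for k
  proof -
    have "linear (\<lambda>x. f x j k *\<^sub>R \<sigma> j k)" for j
      using linear_compose[OF f_lin[rule_format, of j k], of "\<lambda>r. r *\<^sub>R \<sigma> j k"]
      by (simp add: o_def bounded_linear.linear[OF bounded_linear_scaleR_left])
    then show ?thesis unfolding Dk_def by (intro linear_compose_sum) auto
  qed
  ultimately have null: "{x. \<not> cond_as_stable (lindblad M (Dk J \<sigma> (f x))) \<Psi> P} \<in> null_sets lborel"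
    unfolding stable_iff by (intro null_set_singular_regularized)
  \<comment> \<open>The cube is closed, thus measurable, so its intersection with the null set is
    null.\<close>
  have "{x. f x \<in> cube \<gamma>} = (\<Inter>j k. {x. \<bar>f x j k\<bar> \<le> \<gamma>})"
    by (auto simp: cube_def)
  moreover have "closed {x. \<bar>f x j k\<bar> \<le> \<gamma>}" for j k
    using f_lin by (intro closed_Collect_le continuous_intros) (simp add: linear_continuous_on linear_linear)
  ultimately have "closed {x. f x \<in> cube \<gamma>}" by (simp add: closed_INT)
  then have "{x. f x \<in> cube \<gamma>} \<inter> {x. \<not> cond_as_stable (lindblad M (Dk J \<sigma> (f x))) \<Psi> P} \<in> null_sets lborel"
    using null_set_Int2[OF null, of "{x. f x \<in> cube \<gamma>}"] by (simp add: borel_closed Int_commute)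
  then show ?thesis by (simp add: Int_def)
qed

end
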